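(* Let $p>0$ and $a,b\in(0,1)$ with $a+b\le 1$. If $2\le p\le R(a,b)$, then the function $$x\mapsto Q_p(x)=\frac{1}{1-x}\left[\frac{B(a,b)\,F(a,b;a+b;x)}{p-\ln(1-x)}-1\right]$$ is absolutely monotonic on $(0,1)$. In other words, $Q_p(x)$ has a Maclaurin expansion $\sum_{n=0}^{\infty}\alpha_n x^n$ with non-negative coefficients $\alpha_n$.
   Context: For real $a,b,c$ with $c\ne 0,-1,-2,\dots$, $F(a,b;c;x)={}_2F_1(a,b;c;x)=\sum_{n=0}^\infty \frac{(a)_n(b)_n}{(c)_n}\frac{x^n}{n!}$ for $|x|<1$ is the Gaussian hypergeometric function, where $(a)_0=1$ and $(a)_n=a(a+1)\cdots(a+n-1)$ for $n\ge1$. $B(a,b)=\Gamma(a)\Gamma(b)/\Gamma(a+b)$ is the beta function, and $R(a,b)=-\psi(a)-\psi(b)-2\gamma$ is the Ramanujan $R$-function, where $\psi(x)=\frac{d}{dx}\ln\Gamma(x)$ and $\gamma=-\psi(1)$ is Euler's constant. A function $f$ is absolutely monotonic on an interval $I$ if $f^{(n)}(x)\ge 0$ for all $x\in I$ and every integer $n\ge 0$. *)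

theory Defs
  imports "HOL-Analysis.Analysis"
begin

definition gauss_hypergeo :: "real \<Rightarrow> real \<Rightarrow> real \<Rightarrow> real \<Rightarrow> real" where
  "gauss_hypergeo a b c x =
     (\<Sum>n. pochhammer a n * pochhammer b n / pochhammer c n * (x ^ n / fact n))"

lemma gauss_hypergeo_eq_eval_fps:
  "gauss_hypergeo a b c x = eval_fps (fps_hypergeo [a, b] [c] 1) x"
  by (simp add: gauss_hypergeo_def eval_fps_def fps_hypergeo_def)

lemma Digamma_eq_deriv_ln_Gamma:
  "x > 0 \<Longrightarrow> Digamma (x :: real) = deriv (\<lambda>t. ln (Gamma t)) x"
proof -
  assume x: "x > 0"
  have "(ln_Gamma has_field_derivative Digamma x) (at x)"
    using x by (rule has_field_derivative_ln_Gamma_real)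
  moreover have "\<forall>\<^sub>F t in nhds x. ln_Gamma t = ln (Gamma t)"
    using eventually_nhds_in_open[of "{0<..}" x] x
    by (auto elim!: eventually_mono simp: Gamma_real_pos_exp)
  ultimately show ?thesis
    by (metis DERIV_cong_ev DERIV_imp_deriv)
qed

definition Ramanujan_R :: "real \<Rightarrow> real \<Rightarrow> real" where
  "Ramanujan_R a b = - Digamma a - Digamma b - 2 * euler_mascheroni"

(* Since deriv is total and two-sided, differentiability at every order is required
   explicitly, and the notion is the intended one for open I. *)
definition absolutely_monotonic_on :: "real set \<Rightarrow> (real \<Rightarrow> real) \<Rightarrow> bool" where
  "absolutely_monotonic_on I f \<longleftrightarrow>
     (\<forall>n. \<forall>x\<in>I. (deriv ^^ n) f field_differentiable (at x) \<and> (deriv ^^ n) f x \<ge> 0)"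

definition Q :: "real \<Rightarrow> real \<Rightarrow> real \<Rightarrow> real \<Rightarrow> real" where
  "Q a b p x =
     1 / (1 - x) * (Beta a b * gauss_hypergeo a b (a + b) x / (p - ln (1 - x)) - 1)"

end

theory Submission
  imports Defs
begin

text \<open>
  Write \<open>c = a + b\<close>, \<open>t\<^sub>n = B(a,b) (a)\<^sub>n (b)\<^sub>n / ((c)\<^sub>n n!)\<close> for the coefficients of
  \<open>B(a,b) F(a,b;c;x)\<close>, and \<open>S\<^sub>n = B(a,b) + \<Sum>\<^sub>k\<^sub>=\<^sub>1\<^sup>n (t\<^sub>k - 1/k)\<close>.  Since
  \<open>p - ln (1 - x) = p + \<Sum>\<^sub>k\<^sub>\<ge>\<^sub>1 x\<^sup>k/k\<close>, the defining equation of \<open>Q\<^sub>p\<close> reads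
  \<open>Q\<^sub>p(x) (p - ln (1 - x)) = \<Sum>\<^sub>n D\<^sub>n x\<^sup>n\<close> with \<open>D\<^sub>n = S\<^sub>n - p\<close>, so its Maclaurin coefficients
  \<open>\<alpha>\<^sub>n\<close> are determined by \<open>D\<^sub>n = p \<alpha>\<^sub>n + \<Sum>\<^sub>k\<^sub><\<^sub>n \<alpha>\<^sub>k / (n - k)\<close>.

  An induction in the manner of Kaluza (\<open>log_quotient_nonneg\<close>) gives \<open>\<alpha>\<^sub>n \<ge> 0\<close> from three facts:
  \<open>n D\<^sub>n\<close> is nondecreasing from \<open>n = 1\<close> on, \<open>\<alpha>\<^sub>0 \<ge> 0\<close>, and \<open>\<alpha>\<^sub>1 \<ge> 0\<close>, that is, \<open>D\<^sub>0 \<le> p D\<^sub>1\<close>.  It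
  needs \<open>p \<ge> 2\<close> to absorb the term \<open>\<alpha>\<^sub>n\<close> that enters the recurrence at index \<open>n + 1\<close>.

  Everything about \<open>D\<^sub>n\<close> comes from the identity
  \<open>(n+1) t\<^sub>n\<^sub>+\<^sub>1 - n t\<^sub>n = a b t\<^sub>n / (c + n)\<close>.  It shows that \<open>n t\<^sub>n\<close> increases, and Euler's
  limit formula for the Gamma function shows that its limit is 1.  Hence \<open>S\<^sub>n\<close> decreases, and its limit is \<open>R(a,b)\<close>
  (\<open>zb_sum_LIMSEQ\<close>, which is Ramanujan's asymptotics
  \<open>B(a,b) F(a,b;a+b;x) = R(a,b) - ln (1 - x) + o(1)\<close> as \<open>x \<rightarrow> 1\<close> in the language of coefficients).  So
  \<open>D\<^sub>n \<ge> R(a,b) - p \<ge> 0\<close>, and the monotonicity of \<open>n D\<^sub>n\<close> becomes a lower bound for the tails of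
  the limit (\<open>zb_sum_tail_lower\<close>); it follows from telescoping estimates of \<open>1 - n t\<^sub>n\<close>, which use
  \<open>c \<le> 1\<close>.  The inequality \<open>D\<^sub>0 \<le> p D\<^sub>1\<close> is numerical: at \<open>a = b = 1/2\<close> and \<open>p = R(a,b) = 4 ln 2\<close> one
  has only \<open>\<alpha>\<^sub>1 \<approx> 0.008\<close>.  It rests on the bound \<open>R(a,b) \<ge> 4/c - 4 + 4 ln 2\<close>, which is
  an equality there.

  Finally \<open>\<alpha>\<^sub>n \<ge> 0\<close> forces \<open>p \<alpha>\<^sub>n \<le> D\<^sub>n \<le> D\<^sub>0\<close>.  So the series \<open>\<Sum>\<^sub>n \<alpha>\<^sub>n x\<^sup>n\<close> converges for
  \<open>\<bar>x\<bar> < 1\<close>, and a Cauchy product identifies its sum with \<open>Q\<^sub>p\<close>.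
\<close>

section \<open>Coefficients of the zero-balanced hypergeometric function\<close>

definition zb_coeff :: "real \<Rightarrow> real \<Rightarrow> nat \<Rightarrow> real" where
  "zb_coeff a b n = Beta a b * (pochhammer a n * pochhammer b n / (pochhammer (a + b) n * fact n))"

lemma zb_coeff_0 [simp]: "zb_coeff a b 0 = Beta a b"
  by (simp add: zb_coeff_def)

lemma zb_coeff_pos:
  assumes "a > 0" "b > 0"
  shows "zb_coeff a b n > 0"
  using assms by (auto simp: zb_coeff_def Beta_def intro!: mult_pos_pos divide_pos_pos pochhammer_pos)

lemma zb_coeff_Suc:
  assumes "a > 0" "b > 0"
  shows "zb_coeff a b (Suc n) = zb_coeff a b n * ((a + n) * (b + n) / ((a + b + n) * (n + 1)))"
proof -
  have "pochhammer (a + b) n > 0" using assms by (intro pochhammer_pos) auto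
  moreover have "a + b + n > 0" using assms by simp
  ultimately show ?thesis
    by (simp add: zb_coeff_def pochhammer_Suc divide_simps)
qed

lemma zb_coeff_Gamma:
  assumes "a > 0" "b > 0"
  shows "zb_coeff a b n = Gamma (a + n) / fact n * (Gamma (b + n) / Gamma (b + n + a))"
proof -
  have "a \<notin> \<int>\<^sub>\<le>\<^sub>0" "b \<notin> \<int>\<^sub>\<le>\<^sub>0" "a + b \<notin> \<int>\<^sub>\<le>\<^sub>0"
    using assms by (auto elim!: nonpos_Ints_cases)
  moreover have "Gamma a > 0" "Gamma b > 0" "Gamma (a + b) > 0"
    using assms by auto
  ultimately show ?thesis
    by (simp add: zb_coeff_def Beta_def pochhammer_Gamma) (simp add: field_simps)
qed

text \<open>
The increments of \<open>n t\<^sub>n\<close> are again multiples of \<open>t\<^sub>n\<close> because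
\<open>(a + n) (b + n) = n (a + b + n) + a b\<close>.
\<close>
lemma zb_scaled_Suc:
  assumes "a > 0" "b > 0"
  shows "real (Suc n) * zb_coeff a b (Suc n) =
           real n * zb_coeff a b n + a * b * zb_coeff a b n / (a + b + n)"
proof -
  have "a + b + n > 0" using assms by simp
  then show ?thesis
    by (simp add: zb_coeff_Suc[OF assms] divide_simps) (simp add: algebra_simps)
qed

lemma zb_scaled_incseq:
  assumes "a > 0" "b > 0"
  shows "incseq (\<lambda>n. real n * zb_coeff a b n)"
proof (rule incseq_SucI)
  fix n
  have "0 \<le> a * b * zb_coeff a b n / (a + b + n)"
    using assms zb_coeff_pos[OF assms, of n] by simp
  then show "real n * zb_coeff a b n \<le> real (Suc n) * zb_coeff a b (Suc n)"
    unfolding zb_scaled_Suc[OF assms] by linarith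
qed

text \<open>
Euler's limit formula for the Gamma function, applied to each Pochhammer symbol: the powers of
\<open>n\<close> cancel because \<open>a + b - (a + b) = 0\<close>.
\<close>
lemma zb_scaled_LIMSEQ:
  assumes "a > 0" "b > 0"
  shows "(\<lambda>n. real n * zb_coeff a b n) \<longlonglongrightarrow> 1"
proof -
  have nz: "Gamma a \<noteq> 0" "Gamma b \<noteq> 0" "Gamma (a + b) \<noteq> 0"
    using assms by (auto simp: Gamma_eq_zero_iff elim!: nonpos_Ints_cases)
  have "(\<lambda>n. Beta a b * (Gamma_series (a + b) n / (Gamma_series a n * Gamma_series b n)))
          \<longlonglongrightarrow> Beta a b * (Gamma (a + b) / (Gamma a * Gamma b))"
    using nz by (intro tendsto_intros) auto
  also have "Beta a b * (Gamma (a + b) / (Gamma a * Gamma b)) = 1"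
    using nz by (simp add: Beta_def)
  finally have lim: "(\<lambda>n. Beta a b * (Gamma_series (a + b) n / (Gamma_series a n * Gamma_series b n)))
          \<longlonglongrightarrow> 1" .
  have "(\<lambda>n. real (Suc n) * zb_coeff a b (Suc n)) \<longlonglongrightarrow> 1"
  proof (rule Lim_transform_eventually[OF lim])
    show "\<forall>\<^sub>F n in sequentially. Beta a b * (Gamma_series (a + b) n / (Gamma_series a n * Gamma_series b n))
       = real (Suc n) * zb_coeff a b (Suc n)"
    proof (rule eventually_mono[OF eventually_gt_at_top[of 0]])
      fix n :: nat assume "n > 0"
      have "pochhammer a (Suc n) > 0" "pochhammer b (Suc n) > 0" "pochhammer (a + b) (Suc n) > 0"
        using assms by (auto intro!: pochhammer_pos)
      then show "Beta a b * (Gamma_series (a + b) n / (Gamma_series a n * Gamma_series b n))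
       = real (Suc n) * zb_coeff a b (Suc n)"
        by (simp add: Gamma_series_def zb_coeff_def distrib_right exp_add del: pochhammer_Suc of_nat_Suc)
    qed
  qed
  then show ?thesis by (rule LIMSEQ_offset[where k = 1, simplified])
qed

lemma zb_scaled_le_1:
  assumes "a > 0" "b > 0"
  shows "real n * zb_coeff a b n \<le> 1"
  using incseq_le[OF zb_scaled_incseq[OF assms] zb_scaled_LIMSEQ[OF assms]] .

text \<open>
The logarithmic derivative of the ratio is \<open>\<psi>(x) - \<psi>(x + a) \<le> 0\<close>.
\<close>
lemma Gamma_ratio_antimono:
  fixes a x y :: real
  assumes "a > 0" "0 < x" "x \<le> y"
  shows "Gamma y / Gamma (y + a) \<le> Gamma x / Gamma (x + a)"
proof -
  have "ln_Gamma y - ln_Gamma (y + a) \<le> ln_Gamma x - ln_Gamma (x + a)"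
  proof (rule DERIV_nonpos_imp_nonincreasing[OF assms(3)])
    fix t assume t: "x \<le> t" "t \<le> y"
    have "((\<lambda>t. ln_Gamma t - ln_Gamma (t + a)) has_real_derivative (Digamma t - Digamma (t + a))) (at t)"
      using assms t by (auto intro!: derivative_eq_intros)
    moreover have "Digamma t - Digamma (t + a) \<le> 0"
      using Digamma_real_mono[of t "t + a"] assms t by simp
    ultimately show "\<exists>y. ((\<lambda>t. ln_Gamma t - ln_Gamma (t + a)) has_real_derivative y) (at t) \<and> y \<le> 0"
      by blast
  qed
  then have "exp (ln_Gamma y - ln_Gamma (y + a)) \<le> exp (ln_Gamma x - ln_Gamma (x + a))" by simp
  then show ?thesis using assms by (simp add: exp_diff Gamma_real_pos_exp)
qed

lemma zb_coeff_antimono: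
  assumes "a > 0" "0 < b" "b \<le> b'"
  shows "zb_coeff a b' n \<le> zb_coeff a b n"
proof -
  have "Gamma (b' + n) / Gamma (b' + n + a) \<le> Gamma (b + n) / Gamma (b + n + a)"
    using assms by (intro Gamma_ratio_antimono) auto
  moreover have "Gamma (a + n) / fact n \<ge> 0" using assms by (simp add: less_imp_le)
  ultimately show ?thesis
    using assms unfolding zb_coeff_Gamma[OF assms(1,2)] zb_coeff_Gamma[OF assms(1) less_le_trans[OF assms(2,3)]]
    by (intro mult_left_mono)
qed

text \<open>
In terms of this distance of \<open>n t\<^sub>n\<close> from its limit, the summands of the regularised sum below are
\<open>t\<^sub>n - 1/n = - zb_deficit a b n / n\<close>.
\<close>
definition zb_deficit :: "real \<Rightarrow> real \<Rightarrow> nat \<Rightarrow> real" where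
  "zb_deficit a b n = 1 - real n * zb_coeff a b n"

lemma zb_deficit_nonneg:
  assumes "a > 0" "b > 0"
  shows "zb_deficit a b n \<ge> 0"
  using zb_scaled_le_1[OF assms] by (simp add: zb_deficit_def)

lemma zb_deficit_LIMSEQ:
  assumes "a > 0" "b > 0"
  shows "zb_deficit a b \<longlonglongrightarrow> 0"
  using tendsto_diff[OF tendsto_const zb_scaled_LIMSEQ[OF assms], of 1]
  by (simp add: zb_deficit_def[abs_def])

lemma zb_deficit_Suc:
  assumes "a > 0" "b > 0"
  shows "zb_deficit a b (Suc n) = zb_deficit a b n - a * b * zb_coeff a b n / (a + b + n)"
  unfolding zb_deficit_def zb_scaled_Suc[OF assms] by simp

lemma zb_coeff_minus_inverse:
  "n > 0 \<Longrightarrow> zb_coeff a b n - 1 / n = - zb_deficit a b n / n"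
  by (simp add: zb_deficit_def field_simps)

text \<open>
The deficit is a sum of increments \<open>a b t\<^sub>k / (a + b + k) \<le> a b / k\<^sup>2\<close> over \<open>k \<ge> n\<close>, and the tail
of \<open>\<Sum> 1/k\<^sup>2\<close> is at most \<open>2/n\<close>.  The infinite sum is avoided by checking that the difference of the
two sides decreases to 0; the same device is used for the lower bounds that follow.
\<close>
lemma zb_deficit_upper:
  assumes "a > 0" "b > 0" "n > 0"
  shows "zb_deficit a b n \<le> 2 * a * b / n"
proof -
  define y where "y m = 2 * a * b / Suc m - zb_deficit a b (Suc m)" for m
  have "decseq y"
  proof (rule decseq_SucI)
    fix m
    define k where "k = real (Suc m)"
    have k: "k \<ge> 1" by (simp add: k_def)
    have "k * zb_coeff a b (Suc m) \<le> 1"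
      unfolding k_def using assms by (intro zb_scaled_le_1)
    then have "zb_coeff a b (Suc m) \<le> 1 / k" using k by (simp add: field_simps)
    then have "a * b * zb_coeff a b (Suc m) / (a + b + k) \<le> a * b * (1 / k) / (a + b + k)"
      using assms k by (intro divide_right_mono mult_left_mono) auto
    also have "\<dots> \<le> a * b * (1 / k) / k"
      using assms k by (intro divide_left_mono) auto
    also have "\<dots> \<le> 2 * a * b / k - 2 * a * b / (k + 1)"
    proof -
      have "a * b \<le> a * b * k" using assms k by simp
      then show ?thesis using assms k by (simp add: divide_simps) (simp add: algebra_simps)
    qed
    finally show "y (Suc m) \<le> y m"
      using assms by (simp add: y_def zb_deficit_Suc k_def algebra_simps)
  qed
  moreover have "y \<longlonglongrightarrow> 0 - 0"
    unfolding y_def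
    by (intro tendsto_diff LIMSEQ_Suc[OF zb_deficit_LIMSEQ] LIMSEQ_Suc[OF lim_const_over_n] assms)
  ultimately have "y (n - 1) \<ge> 0" using decseq_ge by force
  then show ?thesis using assms by (simp add: y_def)
qed

text \<open>
Since \<open>k t\<^sub>k\<close> increases and \<open>a + b \<le> 1\<close>, the increments for \<open>k \<ge> n\<close> are at least
\<open>a b n t\<^sub>n / (k (k + 1))\<close>, and these telescope to \<open>a b t\<^sub>n\<close>.
\<close>
lemma zb_deficit_lower:
  assumes "a > 0" "b > 0" "a + b \<le> 1" "n > 0"
  shows "zb_deficit a b n \<ge> a * b * zb_coeff a b n"
proof -
  define y where "y m = zb_deficit a b (Suc m) - a * b * zb_coeff a b (Suc m)" for m
  have "decseq y"
  proof (rule decseq_SucI)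
    fix m
    define k t where "k = real (Suc m)" and "t = zb_coeff a b (Suc m)"
    have k: "k \<ge> 1" by (simp add: k_def)
    have t: "t > 0" using zb_coeff_pos assms by (simp add: t_def)
    have "k * t \<le> (k + 1) * zb_coeff a b (Suc (Suc m))"
      using incseqD[OF zb_scaled_incseq[OF assms(1,2)], of "Suc m" "Suc (Suc m)"]
      by (simp add: k_def t_def add_ac)
    then have "zb_coeff a b (Suc (Suc m)) \<ge> k * t / (k + 1)"
      using k by (simp add: field_simps)
    then have "a * b * (k * t / (k + 1)) \<le> a * b * zb_coeff a b (Suc (Suc m))"
      using assms by (intro mult_left_mono) auto
    moreover have "a * b * t - a * b * (k * t / (k + 1)) = a * b * t / (k + 1)"
      using k by (simp add: field_simps)
    moreover have "a * b * t / (k + 1) \<le> a * b * t / (a + b + k)"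
      using assms k t by (intro divide_left_mono) auto
    ultimately show "y (Suc m) \<le> y m"
      using zb_deficit_Suc[OF assms(1,2), of "Suc m"] unfolding y_def t_def k_def by linarith
  qed
  moreover have "y \<longlonglongrightarrow> 0 - a * b * 0"
  proof -
    have "(\<lambda>n. (real n * zb_coeff a b n) * (1 / n)) \<longlonglongrightarrow> 1 * 0"
      by (intro tendsto_mult zb_scaled_LIMSEQ assms lim_const_over_n)
    then have "(\<lambda>n. (real n * zb_coeff a b n) * (1 / n)) \<longlonglongrightarrow> 0" by simp
    then have "zb_coeff a b \<longlonglongrightarrow> 0"
      by (rule Lim_transform_eventually) (rule eventually_mono[OF eventually_gt_at_top[of 0]], simp)
    then show ?thesis
      unfolding y_def
      by (intro tendsto_intros LIMSEQ_Suc[OF zb_deficit_LIMSEQ] LIMSEQ_Suc assms)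
  qed
  ultimately have "y (n - 1) \<ge> 0" using decseq_ge by force
  then show ?thesis using assms by (simp add: y_def)
qed

text \<open>
This is the step of the telescoping argument in \<open>zb_sum_tail_lower\<close>; after inserting the recurrence it
asks for no more than \<open>zb_deficit_lower\<close>.
\<close>
lemma zb_deficit_weighted_mono:
  assumes "a > 0" "b > 0" "a + b \<le> 1" "n > 0"
  shows "(real n - 1) * zb_deficit a b n \<le> real n * zb_deficit a b (Suc n)"
proof -
  have t: "zb_coeff a b n > 0" using zb_coeff_pos assms by simp
  have "n * (a * b * zb_coeff a b n / (a + b + n)) \<le> a * b * zb_coeff a b n"
    using assms t by (simp add: divide_simps)
  with zb_deficit_lower[OF assms] show ?thesis
    by (simp add: zb_deficit_Suc[OF assms(1,2)] algebra_simps)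
qed


section \<open>The regularised sum at 1 is the Ramanujan R-function\<close>

definition zb_sum :: "real \<Rightarrow> real \<Rightarrow> nat \<Rightarrow> real" where
  "zb_sum a b n = Beta a b + (\<Sum>k=1..n. zb_coeff a b k - 1 / k)"

lemma zb_sum_0 [simp]: "zb_sum a b 0 = Beta a b"
  by (simp add: zb_sum_def)

lemma zb_sum_Suc: "zb_sum a b (Suc n) = zb_sum a b n - zb_deficit a b (Suc n) / Suc n"
  using zb_coeff_minus_inverse[of "Suc n" a b] by (simp add: zb_sum_def)

lemma zb_sum_decseq:
  assumes "a > 0" "b > 0"
  shows "decseq (zb_sum a b)"
  by (rule decseq_SucI) (use zb_deficit_nonneg[OF assms] in \<open>simp add: zb_sum_Suc\<close>)

text \<open>
The summands are \<open>O(1/n\<^sup>2)\<close> by \<open>zb_deficit_upper\<close>.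
\<close>
lemma zb_sum_convergent:
  assumes "a > 0" "b > 0"
  shows "convergent (zb_sum a b)"
proof -
  define d where "d k = zb_coeff a b (Suc k) - 1 / Suc k" for k
  have "summable d"
  proof (rule summable_comparison_test')
    have "summable (\<lambda>n. 2 * a * b * inverse (real (Suc n) ^ 2))"
      using inverse_power_summable[where 'a = real and s = 2]
      by (intro summable_mult) (subst summable_Suc_iff[of "\<lambda>n. inverse (real n ^ 2)"], simp)
    then show "summable (\<lambda>n. 2 * a * b * inverse (real (Suc n) ^ 2))" .
    fix n :: nat
    have "norm (d n) = zb_deficit a b (Suc n) / Suc n"
      using zb_deficit_nonneg[OF assms, of "Suc n"] zb_coeff_minus_inverse[of "Suc n" a b]
      by (simp add: d_def)
    also have "\<dots> \<le> (2 * a * b / Suc n) / Suc n"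
      by (intro divide_right_mono zb_deficit_upper assms) auto
    finally show "norm (d n) \<le> 2 * a * b * inverse (real (Suc n) ^ 2)"
      by (simp add: power2_eq_square field_simps)
  qed
  then have "(\<lambda>n. Beta a b + (\<Sum>k<n. d k)) \<longlonglongrightarrow> Beta a b + suminf d"
    by (intro tendsto_intros summable_LIMSEQ)
  moreover have "zb_sum a b = (\<lambda>n. Beta a b + (\<Sum>k<n. d k))"
    by (rule ext) (simp add: zb_sum_def d_def sum.atLeast1_atMost_eq)
  ultimately show ?thesis unfolding convergent_def by auto
qed

lemma zb_coeff_plus1:
  assumes "a > 0" "b > 0"
  shows "zb_coeff a (b + 1) n = zb_coeff a b n * ((b + n) / (a + b + n))"
proof -
  have "Gamma ((b + n) + 1) = (b + n) * Gamma (b + n)"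
    using assms by (intro Gamma_plus1) (auto elim!: nonpos_Ints_cases)
  moreover have "Gamma ((b + n + a) + 1) = (b + n + a) * Gamma (b + n + a)"
    using assms by (intro Gamma_plus1) (auto elim!: nonpos_Ints_cases)
  ultimately show ?thesis
    using assms by (simp add: zb_coeff_Gamma add_ac mult_ac)
qed

text \<open>
In the limit this is the functional equation \<open>L(b) - L(b + 1) = 1/b\<close> that \<open>b \<mapsto> R(a,b)\<close> also
satisfies.  It is exact for partial sums because the difference of the summands is, up to the factor
\<open>1/b\<close>, the increment of \<open>n t\<^sub>n\<close>.
\<close>
lemma zb_sum_diff_plus1:
  assumes "a > 0" "b > 0"
  shows "zb_sum a b n - zb_sum a (b + 1) n = real (Suc n) * zb_coeff a b (Suc n) / b"
proof -
  have *: "zb_coeff a b k - zb_coeff a (b + 1) k = a * b * zb_coeff a b k / (a + b + k) / b" for k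
  proof -
    have "a + b + k > 0" using assms by simp
    then show ?thesis using assms unfolding zb_coeff_plus1[OF assms]
      by (simp add: divide_simps) (simp add: algebra_simps)
  qed
  show ?thesis
  proof (induction n)
    case 0
    show ?case using *[of 0] zb_scaled_Suc[OF assms, of 0] by simp
  next
    case (Suc n)
    have "zb_sum a b (Suc n) - zb_sum a (b + 1) (Suc n) =
            real (Suc n) * zb_coeff a b (Suc n) / b + (zb_coeff a b (Suc n) - zb_coeff a (b + 1) (Suc n))"
      using Suc.IH by (simp add: zb_sum_def)
    also have "\<dots> = (real (Suc n) * zb_coeff a b (Suc n)
                    + a * b * zb_coeff a b (Suc n) / (a + b + Suc n)) / b"
      unfolding * by (simp add: add_divide_distrib)
    finally show ?case unfolding zb_scaled_Suc[OF assms, of "Suc n"] .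
  qed
qed

lemma zb_coeff_one:
  assumes "a > 0"
  shows "zb_coeff a 1 n = 1 / (a + n)"
proof -
  have "Gamma ((a + n) + 1) = (a + n) * Gamma (a + n)"
    using assms by (intro Gamma_plus1) (auto elim!: nonpos_Ints_cases)
  moreover have "Gamma (a + n) \<noteq> 0" using assms Gamma_real_pos[of "a + n"] by linarith
  moreover have "Gamma (1 + real n) = fact n" by (rule Gamma_fact)
  ultimately show ?thesis
    using assms by (simp add: zb_coeff_Gamma add_ac)
qed

text \<open>
For \<open>b = 1\<close> the coefficients are \<open>1/(a + n)\<close>, and the sum is the series of \<open>- \<psi>(a) - \<gamma>\<close>.
\<close>
lemma zb_sum_one_LIMSEQ:
  assumes "a > 0"
  shows "zb_sum a 1 \<longlonglongrightarrow> Ramanujan_R a 1"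
proof -
  define f where "f = (\<lambda>k. inverse (real (Suc k)) - inverse (a + real k))"
  have "summable f"
    unfolding f_def using summable_Digamma[of a] assms by simp
  then have "(\<lambda>n. (\<Sum>k<n. f k)) \<longlonglongrightarrow> Digamma a + euler_mascheroni"
    using summable_LIMSEQ[of f] Digamma_def[of a] by (simp add: f_def)
  then have "(\<lambda>n. 1 / Suc n - (\<Sum>k<Suc n. f k)) \<longlonglongrightarrow> 0 - (Digamma a + euler_mascheroni)"
    by (intro tendsto_diff LIMSEQ_Suc[OF lim_const_over_n] LIMSEQ_Suc)
  moreover have "zb_sum a 1 n = 1 / Suc n - (\<Sum>k<Suc n. f k)" for n
  proof (induction n)
    case 0
    have "Beta a 1 = 1 / a" using zb_coeff_one[OF assms, of 0] by simp
    then show ?case by (simp add: f_def divide_inverse)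
  next
    case (Suc n)
    have "zb_sum a 1 (Suc n) = zb_sum a 1 n + (1 / (a + Suc n) - 1 / Suc n)"
      by (simp add: zb_sum_def zb_coeff_one[OF assms])
    moreover have "f (Suc n) = 1 / Suc (Suc n) - 1 / (a + Suc n)"
      by (simp add: f_def divide_inverse)
    ultimately show ?case unfolding Suc.IH sum.lessThan_Suc[of _ "Suc n"] by simp
  qed
  then have "zb_sum a 1 = (\<lambda>n. 1 / Suc n - (\<Sum>k<Suc n. f k))" by (rule ext)
  ultimately have "zb_sum a 1 \<longlonglongrightarrow> 0 - (Digamma a + euler_mascheroni)" by (simp only:)
  then show ?thesis by (simp add: Ramanujan_R_def add_ac)
qed

lemma zb_sum_antimono:
  assumes "a > 0" "0 < b" "b \<le> b'"
  shows "zb_sum a b' n \<le> zb_sum a b n"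
  unfolding zb_sum_def using zb_coeff_antimono[OF assms] zb_coeff_antimono[OF assms, of 0]
  by (intro add_mono sum_mono diff_mono) auto

lemma Ramanujan_R_plus1: "b > 0 \<Longrightarrow> Ramanujan_R a (b + 1) = Ramanujan_R a b - 1 / b"
  by (simp add: Ramanujan_R_def Digamma_plus1)

lemma Ramanujan_R_antimono:
  "0 < b \<Longrightarrow> b \<le> b' \<Longrightarrow> Ramanujan_R a b' \<le> Ramanujan_R a b"
  using Digamma_real_mono[of b b'] by (simp add: Ramanujan_R_def)

text \<open>
A uniqueness argument in the spirit of Bohr and Mollerup.  The limit \<open>L\<close> and \<open>R(a,\<cdot>)\<close> are both
nonincreasing in \<open>b\<close>, both drop by \<open>1/b\<close> from \<open>b\<close> to \<open>b + 1\<close>, and agree at \<open>b = 1\<close>.  Their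
difference is therefore 1-periodic, vanishes at the positive integers, and between the integers
\<open>m\<close> and \<open>m + 1\<close> is at most the drop \<open>1/m\<close>.  Shifting \<open>b\<close> by large integers shows that it is 0.
\<close>
theorem zb_sum_LIMSEQ:
  assumes a: "a > 0" and b: "b > 0"
  shows "zb_sum a b \<longlonglongrightarrow> Ramanujan_R a b"
proof -
  define L where "L b = lim (zb_sum a b)" for b
  have L: "zb_sum a b \<longlonglongrightarrow> L b" if "b > 0" for b
    using zb_sum_convergent[OF a that] by (simp add: L_def convergent_LIMSEQ_iff)
  have L_plus1: "L (b + 1) = L b - 1 / b" if "b > 0" for b
  proof -
    have "(\<lambda>n. zb_sum a b n - zb_sum a (b + 1) n) \<longlonglongrightarrow> 1 / b"
      unfolding zb_sum_diff_plus1[OF a that]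
      using that by (intro tendsto_divide LIMSEQ_Suc[OF zb_scaled_LIMSEQ[OF a that]] tendsto_const) auto
    moreover have "(\<lambda>n. zb_sum a b n - zb_sum a (b + 1) n) \<longlonglongrightarrow> L b - L (b + 1)"
      using that by (intro tendsto_diff L) auto
    ultimately show ?thesis using LIMSEQ_unique by fastforce
  qed
  have L_antimono: "L b' \<le> L b" if "0 < b" "b \<le> b'" for b b'
    using that by (intro LIMSEQ_le[OF L L]) (auto intro!: zb_sum_antimono a)
  define E where "E b = L b - Ramanujan_R a b" for b
  have E_shift: "E (b + real n) = E b" if "b > 0" for b n
  proof (induction n)
    case (Suc n)
    have "E ((b + n) + 1) = E (b + n)"
      using that by (simp add: E_def L_plus1 Ramanujan_R_plus1)
    then show ?case using Suc by (simp add: add_ac)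
  qed simp
  have "E 1 = 0"
    using LIMSEQ_unique[OF L zb_sum_one_LIMSEQ[OF a]] by (simp add: E_def)
  then have E_nat: "E (real m) = 0" if "m > 0" for m :: nat
    using E_shift[of 1 "m - 1"] that by (simp add: of_nat_diff)
  have E_bound: "\<bar>E b\<bar> \<le> 1 / real (Suc n)" for n
  proof -
    define m where "m = nat \<lfloor>b + Suc n\<rfloor>"
    have m: "Suc n \<le> m" "real m \<le> b + Suc n" "b + Suc n \<le> real m + 1"
      using b unfolding m_def by linarith+
    then have "real m > 0" by linarith
    have "L m = Ramanujan_R a m" using E_nat[of m] m by (simp add: E_def)
    then have "\<bar>E (b + Suc n)\<bar> \<le> 1 / m"
      using L_antimono[of m "b + Suc n"] L_antimono[of "b + Suc n" "real m + 1"]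
        Ramanujan_R_antimono[of m "b + Suc n" a] Ramanujan_R_antimono[of "b + Suc n" "real m + 1" a]
        L_plus1[OF \<open>real m > 0\<close>] Ramanujan_R_plus1[OF \<open>real m > 0\<close>, of a] m b \<open>real m > 0\<close>
      unfolding E_def by linarith
    also have "1 / real m \<le> 1 / real (Suc n)" using m by (intro divide_left_mono) auto
    finally show ?thesis unfolding E_shift[OF b] .
  qed
  have "\<bar>E b\<bar> \<le> 0"
    by (rule LIMSEQ_le_const[OF LIMSEQ_Suc[OF lim_const_over_n[of 1]]]) (use E_bound in blast)
  then show ?thesis using L[OF b] by (simp add: E_def)
qed

section \<open>Monotonicity of the scaled tails\<close>

text \<open>
The left side is \<open>\<Sum>\<^sub>k\<^sub>>\<^sub>n zb_deficit a b k / k\<close>.  The difference of the two sides decreases, by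
\<open>zb_deficit_weighted_mono\<close>, and tends to 0.
\<close>
lemma zb_sum_tail_lower:
  assumes "a > 0" "b > 0" "a + b \<le> 1" "n > 0"
  shows "zb_sum a b n - Ramanujan_R a b \<ge> (real n - 1) / n * zb_deficit a b n"
proof -
  define v where "v m = zb_sum a b (Suc m) - real m / Suc m * zb_deficit a b (Suc m)" for m
  have "decseq v"
  proof (rule decseq_SucI)
    fix m
    define k where "k = real (Suc m)"
    have k: "k > 0" by (simp add: k_def)
    have "(k - 1) * zb_deficit a b (Suc m) \<le> k * zb_deficit a b (Suc (Suc m))"
      using zb_deficit_weighted_mono[OF assms(1-3), of "Suc m"] by (simp add: k_def)
    then have "(k - 1) / k * zb_deficit a b (Suc m) \<le> zb_deficit a b (Suc (Suc m))"
      using k by (simp add: field_simps)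
    also have "\<dots> = (1 / (k + 1) + k / (k + 1)) * zb_deficit a b (Suc (Suc m))"
      using k by (simp flip: add_divide_distrib add: add_ac)
    also have "\<dots> = zb_deficit a b (Suc (Suc m)) / (k + 1) + k / (k + 1) * zb_deficit a b (Suc (Suc m))"
      by (simp add: distrib_right)
    finally show "v (Suc m) \<le> v m"
      by (simp add: v_def zb_sum_Suc k_def add_ac)
  qed
  moreover have "v \<longlonglongrightarrow> Ramanujan_R a b - 1 * 0"
    unfolding v_def
    by (intro tendsto_intros LIMSEQ_Suc[OF zb_sum_LIMSEQ] LIMSEQ_Suc[OF zb_deficit_LIMSEQ]
          LIMSEQ_n_over_Suc_n assms)
  ultimately have "v (n - 1) \<ge> Ramanujan_R a b" using decseq_ge by force
  then show ?thesis using assms by (simp add: v_def of_nat_diff)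
qed

text \<open>
For \<open>p = R(a,b)\<close> this is exactly the tail bound at \<open>n + 1\<close>; a smaller \<open>p\<close> only adds a
nonnegative multiple of \<open>n\<close> to the sequence.
\<close>
lemma scaled_zb_sum_mono:
  assumes "a > 0" "b > 0" "a + b \<le> 1" "p \<le> Ramanujan_R a b"
  shows "real n * (zb_sum a b n - p) \<le> real (Suc n) * (zb_sum a b (Suc n) - p)"
proof -
  have "real n / Suc n * zb_deficit a b (Suc n) \<le> zb_sum a b (Suc n) - p"
    using zb_sum_tail_lower[OF assms(1-3), of "Suc n"] assms(4) by simp
  moreover have "real n * (zb_sum a b n - p) =
      real n * (zb_sum a b (Suc n) - p) + real n / Suc n * zb_deficit a b (Suc n)"
    by (simp add: zb_sum_Suc algebra_simps)
  ultimately show ?thesis by (simp add: algebra_simps)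
qed

section \<open>The first two coefficients\<close>

text \<open>
\<open>\<psi>\<close> is concave on the positive axis, so it lies below its tangent at \<open>3/2\<close>.  The point \<open>3/2\<close> is
where both \<open>a + 1\<close> and \<open>b + 1\<close> lie in the extremal case \<open>a = b = 1/2\<close>.
\<close>
lemma Digamma_tangent_three_halves:
  fixes x :: real
  assumes "x > 0"
  shows "Digamma x \<le> Digamma (3/2) + Polygamma 1 (3/2) * (x - 3/2)"
proof (cases x "3/2 :: real" rule: linorder_cases)
  case less
  have "\<exists>\<xi>. x < \<xi> \<and> \<xi> < 3/2 \<and> Digamma (3/2) - Digamma x = (3/2 - x) * Polygamma (Suc 0) \<xi>"
    using assms less by (intro MVT2 derivative_intros impI allI) (auto elim!: nonpos_Ints_cases)
  then obtain \<xi> where \<xi>: "x < \<xi>" "\<xi> < 3/2" "Digamma (3/2) - Digamma x = (3/2 - x) * Polygamma 1 \<xi>"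
    by auto
  have "(3/2 - x) * Polygamma 1 (3/2) \<le> (3/2 - x) * Polygamma 1 \<xi>"
    using \<xi> assms less Polygamma_real_strict_antimono[of \<xi> "3/2" 1] by (intro mult_left_mono) auto
  with \<xi> show ?thesis by (simp add: algebra_simps)
next
  case greater
  have "\<exists>\<xi>. 3/2 < \<xi> \<and> \<xi> < x \<and> Digamma x - Digamma (3/2) = (x - 3/2) * Polygamma (Suc 0) \<xi>"
    using assms greater by (intro MVT2 derivative_intros impI allI) (auto elim!: nonpos_Ints_cases)
  then obtain \<xi> where \<xi>: "3/2 < \<xi>" "\<xi> < x" "Digamma x - Digamma (3/2) = (x - 3/2) * Polygamma 1 \<xi>"
    by auto
  have "(x - 3/2) * Polygamma 1 \<xi> \<le> (x - 3/2) * Polygamma 1 (3/2)"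
    using \<xi> greater Polygamma_real_strict_antimono[of "3/2" \<xi> 1] by (intro mult_left_mono) auto
  with \<xi> show ?thesis by (simp add: algebra_simps)
next
  case equal
  then show ?thesis by (simp only:) simp
qed

text \<open>
Split off the poles, \<open>R(a,b) = 1/a + 1/b - \<psi>(a + 1) - \<psi>(b + 1) - 2 \<gamma>\<close>.  The tangent bounds for the
two remaining values of \<open>\<psi>\<close> add up to at most \<open>2 \<psi>(3/2)\<close> because \<open>a + b \<le> 1\<close>.
\<close>
lemma Ramanujan_R_lower:
  assumes "a > 0" "b > 0" "a + b \<le> 1"
  shows "Ramanujan_R a b \<ge> 4 / (a + b) - 4 + 4 * ln 2"
proof -
  have "Digamma (1/2 + 1) = Digamma (1/2 :: real) + 1 / (1/2)" by (rule Digamma_plus1) simp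
  then have D: "Digamma (3/2 :: real) = 2 - 2 * ln 2 - euler_mascheroni"
    by (simp add: Digamma_one_half)
  have "Polygamma 1 (3/2 :: real) > 0"
    by (intro Polygamma_real_odd_pos) (auto elim!: nonpos_Ints_cases)
  then have "Polygamma 1 (3/2) * (a + b - 1) \<le> 0"
    using assms by (simp add: mult_nonneg_nonpos)
  moreover have "Digamma (a + 1) + Digamma (b + 1)
      \<le> 2 * Digamma (3/2) + Polygamma 1 (3/2) * (a + b - 1)"
    using Digamma_tangent_three_halves[of "a + 1"] Digamma_tangent_three_halves[of "b + 1"] assms
    by (simp add: algebra_simps)
  moreover have "1 / a + 1 / b \<ge> 4 / (a + b)"
  proof -
    have "1 / a + 1 / b - 4 / (a + b) = (a - b)\<^sup>2 / (a * b * (a + b))"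
      using assms by (simp add: field_simps power2_eq_square)
    also have "\<dots> \<ge> 0" using assms by simp
    finally show ?thesis by simp
  qed
  ultimately show ?thesis
    using assms by (simp add: Ramanujan_R_def Digamma_plus1 D)
qed


text \<open>
This is the inequality \<open>D\<^sub>0 \<le> p D\<^sub>1\<close> at the endpoint \<open>p = R(a,b)\<close>.  With \<open>\<delta>\<^sub>n\<close> for the deficit,
the tail \<open>\<tau> = S\<^sub>1 - R(a,b)\<close> is bounded below through its first two terms and the tail bound at 3.  Then
\<open>\<delta>\<^sub>1\<close>, \<open>\<delta>\<^sub>2\<close>, \<open>\<delta>\<^sub>3\<close> are compared by means of the monotone quantities \<open>\<theta>\<^sub>n = a b n t\<^sub>n\<close>, which leaves
an inequality between \<open>c = a + b\<close> and \<open>r = R(a,b) - 1\<close> alone.  Cutting the tail one term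
earlier, \<open>\<tau> \<ge> \<delta>\<^sub>2\<close>, would be too weak at \<open>a = b = 1/2\<close>.
\<close>
lemma zb_first_ratio:
  assumes a: "a > 0" and b: "b > 0" and ab: "a + b \<le> 1"
  shows "(Ramanujan_R a b - 1) * (zb_sum a b 1 - Ramanujan_R a b) \<ge> zb_deficit a b 1"
proof -
  define c r \<tau> where "c = a + b" and "r = Ramanujan_R a b - 1" and "\<tau> = zb_sum a b 1 - Ramanujan_R a b"
  define \<delta> where "\<delta> = zb_deficit a b"
  define \<theta> where "\<theta> n = a * b * (real n * zb_coeff a b n)" for n
  have c: "0 < c" "c \<le> 1" using assms by (auto simp: c_def)
  have \<theta>_mono: "\<theta> m \<le> \<theta> n" if "m \<le> n" for m n
    unfolding \<theta>_def using assms incseqD[OF zb_scaled_incseq[OF a b] that] by (intro mult_left_mono) auto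
  have \<theta>_pos: "\<theta> n > 0" if "n > 0" for n
    unfolding \<theta>_def using assms zb_coeff_pos[OF a b, of n] that by simp
  have \<tau>: "\<tau> \<ge> \<delta> 2 / 2 + \<delta> 3"
  proof -
    have "zb_sum a b 1 = zb_sum a b 3 + \<delta> 2 / 2 + \<delta> 3 / 3"
      using zb_sum_Suc[of a b 1] zb_sum_Suc[of a b 2] by (simp add: \<delta>_def eval_nat_numeral)
    moreover have "zb_sum a b 3 - Ramanujan_R a b \<ge> 2/3 * \<delta> 3"
      using zb_sum_tail_lower[OF assms, of 3] by (simp add: \<delta>_def)
    ultimately show ?thesis unfolding \<tau>_def by linarith
  qed
  have \<delta>1: "\<delta> 1 = \<theta> 1 / (1 + c) + \<delta> 2"
    using zb_deficit_Suc[OF a b, of 1] by (simp add: \<delta>_def \<theta>_def c_def eval_nat_numeral add_ac)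
  have "\<theta> 2 / (2 * (2 + c)) = a * b * zb_coeff a b 2 / (2 + c)"
    using c by (simp add: \<theta>_def divide_simps)
  then have \<delta>2: "\<delta> 2 = \<theta> 2 / (2 * (2 + c)) + \<delta> 3"
    using zb_deficit_Suc[OF a b, of 2] by (simp add: \<delta>_def c_def eval_nat_numeral add_ac)
  have \<delta>3: "\<delta> 3 \<ge> \<theta> 2 / 3"
    using zb_deficit_lower[OF assms, of 3] \<theta>_mono[of 2 3] by (simp add: \<delta>_def \<theta>_def)
  \<comment> \<open>With \<open>ln 2 \<ge> 2/3\<close> the lower bound on \<open>r\<close> would be too small for \<open>key\<close> at \<open>c = 1\<close>.\<close>
  have ln2: "ln (2::real) \<ge> 0.69"
    using ln_approx_bounds[of 2 3] by (simp add: eval_nat_numeral)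
  have "1 / c \<ge> 2 - c"
  proof -
    have "1 / c - (2 - c) = (1 - c)\<^sup>2 / c"
      using c by (simp add: field_simps power2_eq_square)
    also have "\<dots> \<ge> 0" using c by simp
    finally show ?thesis by simp
  qed
  \<comment> \<open>\<open>1.76 = 4 * 0.69 - 1\<close>\<close>
  then have r: "r \<ge> 1.76 + 4 * (1 - c)"
    using Ramanujan_R_lower[OF assms] ln2 by (simp add: r_def c_def)
  have key: "(3 * r / 2 - 1) / 3 + (r / 2 - 1) / (2 * (2 + c)) \<ge> 1 / (1 + c)"
  proof -
    define u v where "u = (r / 2 - 1) / (2 * (2 + c))" and "v = 1 / (1 + c)"
    have "(- 0.03) * (2 * (2 + c)) \<le> (- 0.12 :: real)" "- 0.12 \<le> r / 2 - 1"
      using r c by (simp_all add: field_simps)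
    then have "(- 0.03) * (2 * (2 + c)) \<le> r / 2 - 1" by (rule order_trans)
    then have "u \<ge> - 0.03" using c by (simp add: u_def pos_le_divide_eq)
    moreover have "v \<le> 1/2 + (1 - c) / 2"
      using c by (simp add: v_def field_simps)
    moreover have "(3 * r / 2 - 1) / 3 \<ge> 0.88 - 1/3 + 2 * (1 - c)" using r by simp
    ultimately have "v \<le> (3 * r / 2 - 1) / 3 + u" using c by (simp add: field_simps)
    then show ?thesis by (simp only: u_def v_def)
  qed
  have "\<theta> 1 / (1 + c) \<le> \<theta> 2 * (1 / (1 + c))"
    using \<theta>_mono[of 1 2] c by (simp add: divide_right_mono)
  also have "\<dots> \<le> \<theta> 2 * ((3 * r / 2 - 1) / 3 + (r / 2 - 1) / (2 * (2 + c)))"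
    using key \<theta>_pos[of 2] by (intro mult_left_mono) auto
  also have "\<dots> = (3 * r / 2 - 1) * (\<theta> 2 / 3) + (r / 2 - 1) * (\<theta> 2 / (2 * (2 + c)))"
    by (simp add: distrib_left mult.commute)
  also have "\<dots> \<le> (3 * r / 2 - 1) * \<delta> 3 + (r / 2 - 1) * (\<theta> 2 / (2 * (2 + c)))"
    using \<delta>3 r c by (intro add_right_mono mult_left_mono) auto
  finally have "\<theta> 1 / (1 + c) \<le> \<dots>" .
  moreover have "r * ((w + d) / 2 + d) - (v + (w + d)) = ((3 * r / 2 - 1) * d + (r / 2 - 1) * w) - v"
    for v w d :: real by (simp add: field_simps)
  from this[of "\<theta> 2 / (2 * (2 + c))" "\<delta> 3" "\<theta> 1 / (1 + c)"]
  have "r * (\<delta> 2 / 2 + \<delta> 3) - \<delta> 1 =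
      ((3 * r / 2 - 1) * \<delta> 3 + (r / 2 - 1) * (\<theta> 2 / (2 * (2 + c)))) - \<theta> 1 / (1 + c)"
    unfolding \<delta>1 \<delta>2 .
  ultimately have "\<delta> 1 \<le> r * (\<delta> 2 / 2 + \<delta> 3)" by linarith
  also have "\<dots> \<le> r * \<tau>" using \<tau> r c by (intro mult_left_mono) auto
  finally show ?thesis by (simp add: r_def \<tau>_def \<delta>_def)
qed

text \<open>
In terms of \<open>\<tau> = S\<^sub>1 - R(a,b)\<close> and the deficit \<open>\<delta>\<close> at 1, the claim is
\<open>\<delta> \<le> (p - 1) (R(a,b) - p + \<tau>)\<close>.  For \<open>\<tau> \<le> 1\<close> the right side is smallest at \<open>p = R(a,b)\<close>, which is
\<open>zb_first_ratio\<close>; for \<open>\<tau> > 1\<close> it exceeds 1, whereas \<open>\<delta> \<le> 1\<close>.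
\<close>
lemma zb_first_two_sums:
  assumes "a > 0" "b > 0" "a + b \<le> 1" "2 \<le> p" "p \<le> Ramanujan_R a b"
  shows "zb_sum a b 0 - p \<le> p * (zb_sum a b 1 - p)"
proof -
  define R \<tau> \<delta> where "R = Ramanujan_R a b" and "\<tau> = zb_sum a b 1 - R" and "\<delta> = zb_deficit a b 1"
  have R: "p \<le> R" "2 \<le> p" using assms by (auto simp: R_def)
  have \<delta>: "0 \<le> \<delta>" "\<delta> \<le> 1"
    using zb_deficit_nonneg[OF assms(1,2), of 1] zb_coeff_pos[OF assms(1,2), of 1]
    by (auto simp: \<delta>_def zb_deficit_def)
  have \<tau>: "\<tau> \<ge> 0" using zb_sum_tail_lower[OF assms(1-3), of 1] by (simp add: \<tau>_def R_def)
  have ratio: "\<delta> \<le> (R - 1) * \<tau>"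
    using zb_first_ratio[OF assms(1-3)] by (simp add: R_def \<tau>_def \<delta>_def)
  have "\<delta> \<le> (p - 1) * (R - p + \<tau>)"
  proof (cases "\<tau> \<le> 1")
    case True
    have "0 \<le> (R - p) * (p - 1 - \<tau>)" using True R by simp
    also have "\<dots> = (p - 1) * (R - p + \<tau>) - (R - 1) * \<tau>" by (simp add: algebra_simps)
    finally show ?thesis using ratio by simp
  next
    case False
    have "1 * 1 \<le> (p - 1) * (R - p + \<tau>)" using False R by (intro mult_mono) auto
    then show ?thesis using \<delta> by simp
  qed
  moreover have "zb_sum a b 0 = zb_sum a b 1 + \<delta>"
    using zb_sum_Suc[of a b 0] by (simp add: \<delta>_def)
  ultimately show ?thesis by (simp add: \<tau>_def algebra_simps)
qed

section \<open>Division of a power series by a shifted logarithm\<close>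

text \<open>
The Maclaurin coefficients of \<open>(\<Sum>\<^sub>n D\<^sub>n x\<^sup>n) / (p - ln (1 - x))\<close>, computed by long division.
\<close>
fun log_quotient :: "real \<Rightarrow> (nat \<Rightarrow> real) \<Rightarrow> nat \<Rightarrow> real" where
  "log_quotient p D n = (D n - (\<Sum>k<n. log_quotient p D k / real (n - k))) / p"

declare log_quotient.simps [simp del]

lemma log_quotient_eq:
  "p \<noteq> 0 \<Longrightarrow> D n = p * log_quotient p D n + (\<Sum>k<n. log_quotient p D k / real (n - k))"
  by (subst log_quotient.simps) simp

text \<open>
A variant of Kaluza's theorem on reciprocals of power series with log-convex coefficients.  Subtract
\<open>m\<close> times the recurrence at \<open>m\<close> from \<open>m + 1\<close> times the recurrence at \<open>m + 1\<close>.  These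
multipliers make the terms with \<open>\<alpha>\<^sub>0\<close> cancel, and by log-convexity of \<open>1/n\<close> every \<open>\<alpha>\<^sub>k\<close> with
\<open>0 < k < m\<close> contributes with the favourable sign to \<open>\<alpha>\<^sub>m\<^sub>+\<^sub>1\<close>.  The term with \<open>\<alpha>\<^sub>m\<close> has
the weight \<open>m p - (m + 1)\<close>, which is nonnegative for all \<open>m \<ge> 1\<close> if \<open>p \<ge> 2\<close>.
\<close>
lemma log_quotient_nonneg:
  assumes p: "p \<ge> 2" and D0: "D 0 \<ge> 0" and D1: "D 0 \<le> p * D 1"
    and mono: "\<And>n. n > 0 \<Longrightarrow> real n * D n \<le> real (Suc n) * D (Suc n)"
  shows "log_quotient p D n \<ge> 0"
proof (induction n rule: less_induct)
  case (less n)
  define \<alpha> where "\<alpha> = log_quotient p D"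
  have D: "D n = p * \<alpha> n + (\<Sum>k<n. \<alpha> k / real (n - k))" for n
    unfolding \<alpha>_def using p by (intro log_quotient_eq) auto
  have IH: "\<alpha> k \<ge> 0" if "k < n" for k using less that by (simp add: \<alpha>_def)
  have \<alpha>0: "\<alpha> 0 = D 0 / p" using D[of 0] p by simp
  consider "n = 0" | "n = 1" | m where "n = Suc m" "m > 0"
    by (metis One_nat_def not0_implies_Suc not_gr_zero)
  then have "\<alpha> n \<ge> 0"
  proof cases
    case 1
    then show ?thesis using \<alpha>0 D0 p by simp
  next
    case 2
    have "p * \<alpha> 1 = D 1 - D 0 / p" using D[of 1] \<alpha>0 by simp
    moreover have "D 0 / p \<le> D 1" using D1 p by (simp add: field_simps)
    ultimately have "p * \<alpha> 1 \<ge> 0" by simp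
    then show ?thesis using 2 p by (simp add: zero_le_mult_iff)
  next
    case 3
    have "(\<Sum>k<m. real (Suc m) * (\<alpha> k / real (Suc m - k))) \<le> (\<Sum>k<m. real m * (\<alpha> k / real (m - k)))"
    proof (rule sum_mono)
      fix k assume "k \<in> {..<m}"
      then have k: "k < m" by simp
      have "real (Suc m) / real (Suc m - k) \<le> real m / real (m - k)"
        using k by (simp add: of_nat_diff divide_simps) (simp add: algebra_simps)
      from mult_left_mono[OF this IH[of k]]
      show "real (Suc m) * (\<alpha> k / real (Suc m - k)) \<le> real m * (\<alpha> k / real (m - k))"
        using k 3 by (simp add: mult_ac)
    qed
    moreover have "real (Suc m) * \<alpha> m \<le> real m * (p * \<alpha> m)"
    proof -
      have "real m * 2 \<le> real m * p" using p by (intro mult_left_mono) auto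
      then have "real (Suc m) \<le> real m * p" using 3 by linarith
      from mult_right_mono[OF this IH[of m]] show ?thesis using 3 by (simp add: mult_ac)
    qed
    moreover have "real m * D m = real m * (p * \<alpha> m) + (\<Sum>k<m. real m * (\<alpha> k / real (m - k)))"
      unfolding D[of m] by (simp only: distrib_left sum_distrib_left)
    moreover have "real (Suc m) * D (Suc m) = real (Suc m) * (p * \<alpha> (Suc m)) +
        (\<Sum>k<m. real (Suc m) * (\<alpha> k / real (Suc m - k))) + real (Suc m) * \<alpha> m"
      unfolding D[of "Suc m"] by (simp only: distrib_left sum_distrib_left sum.lessThan_Suc) simp
    ultimately have "real (Suc m) * (p * \<alpha> (Suc m)) \<ge> 0"
      using mono[of m] 3 by linarith
    then show ?thesis using 3 p by (simp add: zero_le_mult_iff)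
  qed
  then show ?case by (simp add: \<alpha>_def)
qed

lemma summable_norm_bounded_power:
  fixes c :: "nat \<Rightarrow> real"
  assumes "\<And>n. \<bar>c n\<bar> \<le> M" "\<bar>x\<bar> < 1"
  shows "summable (\<lambda>n. norm (c n * x ^ n))"
proof (rule summable_comparison_test')
  show "summable (\<lambda>n. M * \<bar>x\<bar> ^ n)"
    using assms by (intro summable_mult summable_geometric) simp
  show "norm (norm (c n * x ^ n)) \<le> M * \<bar>x\<bar> ^ n" for n
    using assms(1)[of n] by (simp add: abs_mult power_abs mult_right_mono)
qed

lemma ln_one_minus_less_1:
  fixes x :: real
  assumes "\<bar>x\<bar> < 1"
  shows "ln (1 - x) < 1"
proof -
  have "ln (1 - x) < ln 2" using assms by (subst ln_less_cancel_iff) auto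
  then show ?thesis using ln_2_less_1 by linarith
qed

lemma log_shift_sums:
  fixes x p :: real
  assumes "\<bar>x\<bar> < 1"
  shows "(\<lambda>n. (if n = 0 then p else 1 / n) * x ^ n) sums (p - ln (1 - x))"
proof -
  have "(\<lambda>n. (if n = 0 then p else 0) - (- ((- (- x)) ^ n) / real n)) sums (p - ln (1 + (- x)))"
    using assms by (intro sums_diff ln_series' sums_single[of 0 "\<lambda>_. p"]) simp
  also have "(\<lambda>n. (if n = 0 then p else 0) - (- ((- (- x)) ^ n) / real n))
           = (\<lambda>n. (if n = 0 then p else 1 / n) * x ^ n)"
    by (rule ext) simp
  finally show ?thesis by simp
qed

text \<open>
Convergence on the whole unit interval is a consequence of nonnegativity: all terms of the recurrence
are nonnegative, so \<open>\<alpha>\<^sub>n\<close> is bounded by \<open>D\<^sub>n / p\<close>.  The zeros of the complex denominator never have to be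
located.
\<close>
lemma log_quotient_sums:
  assumes p: "p \<ge> 1" and nonneg: "\<And>n. log_quotient p D n \<ge> 0" and bound: "\<And>n. D n \<le> M"
    and x: "\<bar>x\<bar> < 1" and D: "(\<lambda>n. D n * x ^ n) sums s"
  shows "(\<lambda>n. log_quotient p D n * x ^ n) sums (s / (p - ln (1 - x)))"
proof -
  define \<alpha> where "\<alpha> = log_quotient p D"
  define \<beta> :: "nat \<Rightarrow> real" where "\<beta> n = (if n = 0 then p else 1 / n)" for n
  have D_eq: "D n = p * \<alpha> n + (\<Sum>k<n. \<alpha> k / real (n - k))" for n
    unfolding \<alpha>_def using p by (intro log_quotient_eq) auto
  have \<alpha>_bound: "\<bar>\<alpha> n\<bar> \<le> M" for n
  proof -
    have "1 * \<alpha> n \<le> p * \<alpha> n" using p nonneg[of n] by (intro mult_right_mono) (auto simp: \<alpha>_def)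
    also have "\<dots> \<le> D n"
      unfolding D_eq[of n] \<alpha>_def by (simp add: sum_nonneg nonneg del: of_nat_diff)
    finally show ?thesis using bound[of n] nonneg[of n] by (simp add: \<alpha>_def)
  qed
  have \<alpha>_sm: "summable (\<lambda>n. norm (\<alpha> n * x ^ n))"
    by (rule summable_norm_bounded_power[OF \<alpha>_bound x])
  have \<beta>_bound: "\<bar>\<beta> n\<bar> \<le> p" for n
  proof (cases "n = 0")
    case False
    then have "1 / real n \<le> 1" by simp
    then have "1 / real n \<le> p" using p by linarith
    then show ?thesis unfolding \<beta>_def using False by simp
  qed (use p in \<open>simp add: \<beta>_def\<close>)
  have \<beta>_sm: "summable (\<lambda>n. norm (\<beta> n * x ^ n))"
    by (rule summable_norm_bounded_power[OF \<beta>_bound x])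
  have \<beta>_sums: "(\<lambda>n. \<beta> n * x ^ n) sums (p - ln (1 - x))"
    unfolding \<beta>_def by (rule log_shift_sums[OF x])
  have "(\<lambda>n. \<Sum>i\<le>n. (\<alpha> i * x ^ i) * (\<beta> (n - i) * x ^ (n - i))) sums
          ((\<Sum>n. \<alpha> n * x ^ n) * (\<Sum>n. \<beta> n * x ^ n))"
    by (rule Cauchy_product_sums[OF \<alpha>_sm \<beta>_sm])
  moreover have "(\<Sum>i\<le>n. (\<alpha> i * x ^ i) * (\<beta> (n - i) * x ^ (n - i))) = D n * x ^ n" for n
  proof -
    have "(\<Sum>i\<le>n. (\<alpha> i * x ^ i) * (\<beta> (n - i) * x ^ (n - i))) = (\<Sum>i\<le>n. \<alpha> i * \<beta> (n - i)) * x ^ n"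
      unfolding sum_distrib_right by (intro sum.cong) (auto simp: power_add[symmetric] mult_ac)
    also have "(\<Sum>i\<le>n. \<alpha> i * \<beta> (n - i)) = p * \<alpha> n + (\<Sum>i<n. \<alpha> i * \<beta> (n - i))"
      by (simp add: lessThan_Suc_atMost[symmetric] \<beta>_def)
    also have "(\<Sum>i<n. \<alpha> i * \<beta> (n - i)) = (\<Sum>i<n. \<alpha> i / real (n - i))"
      by (intro sum.cong) (auto simp: \<beta>_def)
    finally show ?thesis by (simp add: D_eq)
  qed
  ultimately have "(\<Sum>n. \<alpha> n * x ^ n) * (p - ln (1 - x)) = s"
    using sums_unique[OF \<beta>_sums] sums_unique2[OF D] by simp
  moreover have "p - ln (1 - x) > 0" using ln_one_minus_less_1[OF x] p by simp
  ultimately have "(\<Sum>n. \<alpha> n * x ^ n) = s / (p - ln (1 - x))" by (simp add: field_simps)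
  then show ?thesis
    using summable_sums[OF summable_norm_cancel[OF \<alpha>_sm]] by (simp add: \<alpha>_def)
qed

section \<open>Power series with nonnegative coefficients\<close>

lemma power_series_differentiable:
  fixes \<alpha> :: "nat \<Rightarrow> real"
  assumes f: "\<And>x. \<bar>x\<bar> < 1 \<Longrightarrow> (\<lambda>n. \<alpha> n * x ^ n) sums f x" and x: "\<bar>x\<bar> < 1"
  shows "f field_differentiable (at x)" and "(\<lambda>n. diffs \<alpha> n * x ^ n) sums deriv f x"
proof -
  have "((\<lambda>z. \<Sum>n. \<alpha> n * z ^ n) has_field_derivative (\<Sum>n. diffs \<alpha> n * x ^ n)) (at x)"
    by (rule termdiffs_strong'[of 1]) (use x f sums_summable in auto)
  moreover have "\<forall>\<^sub>F z in nhds x. (\<Sum>n. \<alpha> n * z ^ n) = f z"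
  proof (rule eventually_mono)
    show "\<forall>\<^sub>F z in nhds x. z \<in> ball 0 1"
      using eventually_nhds_in_open[of "ball 0 1" x] x by simp
    show "(\<Sum>n. \<alpha> n * z ^ n) = f z" if "z \<in> ball 0 1" for z
      using sums_unique[OF f[of z]] that by simp
  qed
  ultimately have D: "(f has_field_derivative (\<Sum>n. diffs \<alpha> n * x ^ n)) (at x)"
    by (rule DERIV_cong_ev[OF refl _ refl, THEN iffD1, rotated])
  then show "f field_differentiable (at x)" by (auto simp: field_differentiable_def)
  show "(\<lambda>n. diffs \<alpha> n * x ^ n) sums deriv f x"
    using termdiffs_sums_strong[of 1 \<alpha> f _ x] f D x DERIV_imp_deriv[OF D] by simp
qed

text \<open>
Termwise differentiation keeps both hypotheses, so the induction on the order of the derivative runs over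
all such functions at once.
\<close>
lemma absolutely_monotonic_on_power_series:
  fixes \<alpha> :: "nat \<Rightarrow> real"
  assumes "\<And>n. \<alpha> n \<ge> 0" "\<And>x. \<bar>x\<bar> < 1 \<Longrightarrow> (\<lambda>n. \<alpha> n * x ^ n) sums f x"
  shows "absolutely_monotonic_on {0<..<1} f"
proof -
  have "(deriv ^^ n) f field_differentiable (at x) \<and> (deriv ^^ n) f x \<ge> 0" if x: "x \<in> {0<..<1}" for n x
    using assms
  proof (induction n arbitrary: f \<alpha>)
    case 0
    have "f field_differentiable (at x)"
      using power_series_differentiable(1)[OF 0(2)] x by simp
    moreover have "f x \<ge> 0"
    proof (rule sums_le[OF _ sums_zero])
      show "(\<lambda>n. \<alpha> n * x ^ n) sums f x" using 0(2) x by simp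
      show "0 \<le> \<alpha> n * x ^ n" for n using 0(1) x by simp
    qed
    ultimately show ?case by simp
  next
    case (Suc n)
    have "(deriv ^^ n) (deriv f) field_differentiable (at x) \<and> (deriv ^^ n) (deriv f) x \<ge> 0"
    proof (rule Suc.IH)
      show "diffs \<alpha> n \<ge> 0" for n using Suc.prems(1) by (simp add: diffs_def)
      show "(\<lambda>n. diffs \<alpha> n * x ^ n) sums deriv f x" if "\<bar>x\<bar> < 1" for x
        by (rule power_series_differentiable(2)[OF Suc.prems(2) that])
    qed
    then show ?case by (simp add: funpow_swap1)
  qed
  then show ?thesis by (simp add: absolutely_monotonic_on_def)
qed

section \<open>The Maclaurin expansion of Q\<close>

lemma Beta_gauss_hypergeo_sums:
  assumes "a > 0" "b > 0" and x: "\<bar>x\<bar> < 1"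
  shows "(\<lambda>n. zb_coeff a b n * x ^ n) sums (Beta a b * gauss_hypergeo a b (a + b) x)"
proof -
  have bound: "\<bar>zb_coeff a b n\<bar> \<le> max 1 (Beta a b)" for n
  proof (cases "n = 0")
    case True
    have "zb_coeff a b n = Beta a b" by (simp add: True)
    then show ?thesis using zb_coeff_pos[OF assms(1,2), of n] by linarith
  next
    case False
    have "1 * zb_coeff a b n \<le> real n * zb_coeff a b n"
      using zb_coeff_pos[OF assms(1,2), of n] False by (intro mult_right_mono) auto
    then show ?thesis
      using zb_scaled_le_1[OF assms(1,2), of n] zb_coeff_pos[OF assms(1,2), of n] by linarith
  qed
  define g where "g = (\<lambda>n. pochhammer a n * pochhammer b n / pochhammer (a + b) n * (x ^ n / fact n))"
  have eq: "zb_coeff a b n * x ^ n = Beta a b * g n" for n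
    by (simp add: zb_coeff_def g_def)
  have "Beta a b \<noteq> 0" using zb_coeff_pos[OF assms(1,2), of 0] by simp
  moreover have "summable (\<lambda>n. Beta a b * g n)"
    unfolding eq[symmetric] by (rule summable_norm_cancel, rule summable_norm_bounded_power[OF bound x])
  ultimately have "summable g" by (simp add: summable_cmult_iff)
  then have "g sums gauss_hypergeo a b (a + b) x"
    by (simp add: gauss_hypergeo_def g_def summable_sums)
  then show ?thesis unfolding eq by (rule sums_mult)
qed

text \<open>
Division by \<open>1 - x\<close> turns the coefficients \<open>B(a,b) - p\<close> and \<open>t\<^sub>n - 1/n\<close> of the numerator into their
partial sums.
\<close>
lemma zb_sum_sums:
  assumes "a > 0" "b > 0" and x: "\<bar>x\<bar> < 1"
  shows "(\<lambda>n. (zb_sum a b n - p) * x ^ n) sums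
           ((Beta a b * gauss_hypergeo a b (a + b) x - (p - ln (1 - x))) / (1 - x))"
proof -
  define d where "d n = (if n = 0 then Beta a b - p else zb_coeff a b n - 1 / n)" for n
  have d_sum: "(\<Sum>i\<le>n. d i) = zb_sum a b n - p" for n
    by (induction n) (simp_all add: d_def zb_sum_def)
  have d_bound: "\<bar>d n\<bar> \<le> max 1 \<bar>Beta a b - p\<bar>" for n
  proof (cases "n = 0")
    case False
    have "\<bar>d n\<bar> = zb_deficit a b n / n"
      using False zb_deficit_nonneg[OF assms(1,2), of n] zb_coeff_minus_inverse[of n a b] by (simp add: d_def)
    also have "\<dots> \<le> 1 / 1"
      using False zb_coeff_pos[OF assms(1,2), of n] zb_deficit_nonneg[OF assms(1,2), of n]
      by (intro frac_le) (auto simp: zb_deficit_def)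
    finally show ?thesis by simp
  qed (simp add: d_def)
  have d_sm: "summable (\<lambda>n. norm (d n * x ^ n))"
    by (rule summable_norm_bounded_power[OF d_bound x])
  have one_sm: "summable (\<lambda>n. norm (x ^ n))"
    using summable_norm_bounded_power[of "\<lambda>_. 1" 1 x] x by simp
  have "(\<lambda>n. zb_coeff a b n * x ^ n - (if n = 0 then p else 1 / n) * x ^ n) sums
         (Beta a b * gauss_hypergeo a b (a + b) x - (p - ln (1 - x)))"
    by (intro sums_diff Beta_gauss_hypergeo_sums log_shift_sums assms)
  also have "(\<lambda>n. zb_coeff a b n * x ^ n - (if n = 0 then p else 1 / n) * x ^ n) = (\<lambda>n. d n * x ^ n)"
    by (rule ext) (simp add: d_def left_diff_distrib)
  finally have d_sums: "(\<lambda>n. d n * x ^ n) sums (Beta a b * gauss_hypergeo a b (a + b) x - (p - ln (1 - x)))" .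
  have "(\<Sum>i\<le>n. (d i * x ^ i) * x ^ (n - i)) = (zb_sum a b n - p) * x ^ n" for n
  proof -
    have "(\<Sum>i\<le>n. (d i * x ^ i) * x ^ (n - i)) = (\<Sum>i\<le>n. d i) * x ^ n"
      unfolding sum_distrib_right by (intro sum.cong) (auto simp: power_add[symmetric] mult_ac)
    then show ?thesis by (simp add: d_sum)
  qed
  with Cauchy_product_sums[OF d_sm one_sm] show ?thesis
    using sums_unique[OF d_sums] suminf_geometric[of x] x by simp
qed

theorem theorem1:
  fixes a b p :: real
  assumes "p > 0"
    and "a \<in> {0<..<1}" and "b \<in> {0<..<1}" and "a + b \<le> 1"
    and "2 \<le> p" and "p \<le> Ramanujan_R a b"
  shows "absolutely_monotonic_on {0<..<1} (Q a b p)
    \<and> (\<exists>\<alpha> :: nat \<Rightarrow> real. (\<forall>n. \<alpha> n \<ge> 0)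
         \<and> (\<forall>x. \<bar>x\<bar> < 1 \<longrightarrow> (\<lambda>n. \<alpha> n * x ^ n) sums Q a b p x))"
proof -
  have ab: "a > 0" "b > 0" using assms by auto
  define D where "D n = zb_sum a b n - p" for n
  define \<alpha> where "\<alpha> = log_quotient p D"
  have D_nonneg: "D n \<ge> 0" for n
    using decseq_ge[OF zb_sum_decseq[OF ab] zb_sum_LIMSEQ[OF ab], of n] assms by (simp add: D_def)
  have D_bound: "D n \<le> D 0" for n
    using decseqD[OF zb_sum_decseq[OF ab], of 0 n] by (simp add: D_def)
  have \<alpha>_nonneg: "\<alpha> n \<ge> 0" for n
    unfolding \<alpha>_def
  proof (rule log_quotient_nonneg)
    show "D 0 \<le> p * D 1"
      unfolding D_def using zb_first_two_sums ab assms by blast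
    show "real n * D n \<le> real (Suc n) * D (Suc n)" for n
      unfolding D_def using scaled_zb_sum_mono ab assms by blast
  qed (use assms D_nonneg in auto)
  have \<alpha>_sums: "(\<lambda>n. \<alpha> n * x ^ n) sums Q a b p x" if x: "\<bar>x\<bar> < 1" for x
  proof -
    define h where "h = p - ln (1 - x)"
    have "h \<noteq> 0" using ln_one_minus_less_1[OF x] assms by (simp add: h_def)
    have "(\<lambda>n. \<alpha> n * x ^ n) sums
        ((Beta a b * gauss_hypergeo a b (a + b) x - h) / (1 - x) / h)"
      unfolding \<alpha>_def h_def
    proof (rule log_quotient_sums[OF _ _ D_bound x])
      show "p \<ge> 1" using assms by simp
      show "log_quotient p D n \<ge> 0" for n using \<alpha>_nonneg by (simp add: \<alpha>_def)
      show "(\<lambda>n. D n * x ^ n) sums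
          ((Beta a b * gauss_hypergeo a b (a + b) x - (p - ln (1 - x))) / (1 - x))"
        unfolding D_def by (rule zb_sum_sums[OF ab x])
    qed
    also have "(Beta a b * gauss_hypergeo a b (a + b) x - h) / (1 - x) / h =
        1 / (1 - x) * (Beta a b * gauss_hypergeo a b (a + b) x / h - h / h)"
      unfolding diff_divide_distrib[symmetric] by simp
    also have "\<dots> = Q a b p x" using \<open>h \<noteq> 0\<close> by (simp add: Q_def h_def)
    finally show ?thesis .
  qed
  show ?thesis
    using absolutely_monotonic_on_power_series[OF \<alpha>_nonneg \<alpha>_sums] \<alpha>_nonneg \<alpha>_sums by blast
qed

end
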